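(* Let $K\subset\{(x,y)\in\mathbb{R}^2:0<x\le y\}$ be compact, $E=\{\xi\in\mathbb{R}^{2\times2}:(\lambda_1(\xi),\lambda_2(\xi))\in K\}$, and let $\xi\in\operatorname{int}E^{rc}$. Then there exists an in-approximation $(U_n)_{n\ge1}$ of $E$ such that $\xi\in U_1$.
   Context: $\lambda_1(\xi)\le\lambda_2(\xi)$ are the singular values of $\xi\in\mathbb{R}^{2\times2}$ (eigenvalues of $\sqrt{\xi\xi^t}$). For compact $C$, $C^{rc}=\{\xi: f(\xi)\le0$ for every rank one convex $f:\mathbb{R}^{2\times2}\to\mathbb{R}$ with $f|_C\le0\}$; for open $U$, $U^{rc}=\bigcup_{C\subset U\text{ compact}}C^{rc}$. A function is rank one convex if it is convex along every segment $[\xi,\eta]$ with $\operatorname{rank}(\xi-\eta)=1$. A sequence of open sets $U_i$ is an in-approximation of a compact set $E$ if $U_i\subseteq U_{i+1}^{rc}$ for all $i$ and $\sup_{\eta\in U_i}\operatorname{dist}(\eta,E)\to0$ as $i\to\infty$. *)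

theory Defs
  imports "HOL-Analysis.Analysis"
begin

type_synonym mat2 = "real^2^2"

text \<open>Singular values (lambda1 <= lambda2) of a 2x2 real matrix: the eigenvalues of
  sqrt(xi xi^t), counted with multiplicity, i.e. the nonnegative numbers a <= b whose
  squares are the eigenvalues (with multiplicity) of xi xi^t:
  det(t I - xi xi^t) = (t - a^2)(t - b^2) for all t.\<close>
definition sing_vals :: "mat2 \<Rightarrow> real \<times> real" where
  "sing_vals \<xi> = (THE (a, b). 0 \<le> a \<and> a \<le> b \<and>
      (\<forall>t. det (t *\<^sub>R mat 1 - \<xi> ** transpose \<xi>) = (t - a\<^sup>2) * (t - b\<^sup>2)))"

definition rank_one_convex :: "(mat2 \<Rightarrow> real) \<Rightarrow> bool" where
  "rank_one_convex f \<longleftrightarrow> (\<forall>\<xi> \<eta>. rank (\<xi> - \<eta>) = 1 \<longrightarrow>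
      (\<forall>t::real. 0 \<le> t \<and> t \<le> 1 \<longrightarrow>
         f ((1 - t) *\<^sub>R \<xi> + t *\<^sub>R \<eta>) \<le> (1 - t) * f \<xi> + t * f \<eta>))"

definition rc_hull_compact :: "mat2 set \<Rightarrow> mat2 set" where
  "rc_hull_compact C = {\<xi>. \<forall>f. rank_one_convex f \<and> (\<forall>x\<in>C. f x \<le> 0) \<longrightarrow> f \<xi> \<le> 0}"

definition rc_hull_open :: "mat2 set \<Rightarrow> mat2 set" where
  "rc_hull_open U = (\<Union>C\<in>{C. compact C \<and> C \<subseteq> U}. rc_hull_compact C)"

text \<open>In-approximation of a compact set E: open sets U i with U i \<subseteq> (U (i+1))^rc and
  sup_{eta in U i} dist(eta, E) \<rightarrow> 0 (written with epsilon to avoid Sup of unbounded sets).\<close>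
definition in_approximation :: "(nat \<Rightarrow> mat2 set) \<Rightarrow> mat2 set \<Rightarrow> bool" where
  "in_approximation U E \<longleftrightarrow> (\<forall>i. open (U i)) \<and> (\<forall>i. U i \<subseteq> rc_hull_open (U (Suc i))) \<and>
     (\<forall>\<epsilon>>0. \<exists>N. \<forall>i\<ge>N. \<forall>\<eta>\<in>U i. infdist \<eta> E \<le> \<epsilon>)"

end

theory Submission
  imports Defs
begin

text \<open>Scaling alone produces the in-approximation. If \<open>\<eta> \<in> E\<close> has singular values \<open>(a, b)\<close>,
  isotropy puts the four matrices corresponding to \<open>diag(\<plusminus>a, \<plusminus>b)\<close> into \<open>E\<close>, so rank one convexity along
  the sides of this rectangle yields \<open>\<lambda>\<^sub>1 < a, \<lambda>\<^sub>2 < b \<Longrightarrow> \<zeta> \<in> E\<^sup>r\<^sup>c\<close>. As \<open>a > 0\<close>, this open set contains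
  \<open>t\<eta>\<close> for \<open>0 < t < 1\<close>, hence \<open>t E \<subseteq> int E\<^sup>r\<^sup>c\<close>. For \<open>t\<^sub>n\<close> increasing to 1, the sets
  \<open>U\<^sub>n = int (t\<^sub>n\<^sub>+\<^sub>1 E)\<^sup>r\<^sup>c \<inter> {dist(\<cdot>, E) < c/(n+1)}\<close> contain \<open>t\<^sub>n E\<close> and form an in-approximation;
  \<open>\<xi> \<in> U\<^sub>0\<close> holds once \<open>t\<^sub>1\<close> is so close to 1 that \<open>\<xi>/t\<^sub>1\<close> is still interior to \<open>E\<^sup>r\<^sup>c\<close>.\<close>

definition mat2_of :: "real \<Rightarrow> real \<Rightarrow> real \<Rightarrow> real \<Rightarrow> mat2" where
  "mat2_of p q r s = vector [vector [p, q], vector [r, s]]"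

lemma mat2_of_nth [simp]:
  "mat2_of p q r s $ 1 $ 1 = p" "mat2_of p q r s $ 1 $ 2 = q"
  "mat2_of p q r s $ 2 $ 1 = r" "mat2_of p q r s $ 2 $ 2 = s"
  by (simp_all add: mat2_of_def)

lemma mat2_eq_iff:
  fixes M N :: mat2
  shows "M = N \<longleftrightarrow> M$1$1 = N$1$1 \<and> M$1$2 = N$1$2 \<and> M$2$1 = N$2$1 \<and> M$2$2 = N$2$2"
  by (auto simp: vec_eq_iff forall_2)

lemma norm_mat2_sq:
  fixes M :: mat2
  shows "(norm M)\<^sup>2 = (M$1$1)\<^sup>2 + (M$1$2)\<^sup>2 + (M$2$1)\<^sup>2 + (M$2$2)\<^sup>2"
  unfolding power2_norm_eq_inner by (simp add: inner_vec_def sum_2 power2_eq_square)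

lemma det_mult_transpose_char:
  fixes M :: mat2
  shows "det (t *\<^sub>R mat 1 - M ** transpose M) = t\<^sup>2 - (norm M)\<^sup>2 * t + (det M)\<^sup>2"
  unfolding norm_mat2_sq
  by (simp add: det_2 matrix_matrix_mult_def transpose_def sum_2 mat_def)
    (simp add: power2_eq_square algebra_simps)

lemma abs_det_le_norm_sq:
  fixes M :: mat2
  shows "2 * \<bar>det M\<bar> \<le> (norm M)\<^sup>2"
proof -
  have "0 \<le> (M$1$1 - M$2$2)\<^sup>2 + (M$1$2 + M$2$1)\<^sup>2" "0 \<le> (M$1$1 + M$2$2)\<^sup>2 + (M$1$2 - M$2$1)\<^sup>2"
    by simp_all
  then show ?thesis
    unfolding norm_mat2_sq det_2 by (simp add: power2_eq_square algebra_simps abs_if)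
qed

lemma sing_vals_eqI:
  fixes M :: mat2
  assumes "0 \<le> a" "a \<le> b" "a\<^sup>2 + b\<^sup>2 = (norm M)\<^sup>2" "a * b = \<bar>det M\<bar>"
  shows "sing_vals M = (a, b)"
  unfolding sing_vals_def
proof (rule the_equality)
  have d: "(det M)\<^sup>2 = a\<^sup>2 * b\<^sup>2"
    by (metis assms(4) power2_abs power_mult_distrib)
  show "case (a, b) of (a, b) \<Rightarrow> 0 \<le> a \<and> a \<le> b \<and>
      (\<forall>t. det (t *\<^sub>R mat 1 - M ** transpose M) = (t - a\<^sup>2) * (t - b\<^sup>2))"
    using assms(1,2) unfolding det_mult_transpose_char assms(3)[symmetric] d
    by (simp add: algebra_simps power2_eq_square)
  fix p
  assume p: "case p of (a, b) \<Rightarrow> 0 \<le> a \<and> a \<le> b \<and>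
      (\<forall>t. det (t *\<^sub>R mat 1 - M ** transpose M) = (t - a\<^sup>2) * (t - b\<^sup>2))"
  obtain c e where ce: "p = (c, e)" by force
  have c: "0 \<le> c" "c \<le> e"
    and eq: "\<And>t. t\<^sup>2 - (a\<^sup>2 + b\<^sup>2) * t + a\<^sup>2 * b\<^sup>2 = (t - c\<^sup>2) * (t - e\<^sup>2)"
    using p unfolding ce det_mult_transpose_char assms(3)[symmetric] d by auto
  have "(a * b)\<^sup>2 = (c * e)\<^sup>2"
    using eq[of 0] by (simp add: power_mult_distrib)
  then have prod: "a * b = c * e"
    using assms(1,2) c by (simp add: power2_eq_iff_nonneg)
  have sum: "a\<^sup>2 + b\<^sup>2 = c\<^sup>2 + e\<^sup>2"
    using eq[of 0] eq[of 1] by (simp add: algebra_simps)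
  have "(a + b)\<^sup>2 = (c + e)\<^sup>2" "(b - a)\<^sup>2 = (e - c)\<^sup>2"
    using prod sum by (simp_all add: power2_sum power2_diff algebra_simps)
  then have "a + b = c + e" "b - a = e - c"
    using assms(1,2) c by (simp_all add: power2_eq_iff_nonneg)
  then show "p = (a, b)"
    by (simp add: ce)
qed

lemma
  fixes M :: mat2
  shows sing_vals_formula: "sing_vals M =
      ((sqrt ((norm M)\<^sup>2 + 2 * \<bar>det M\<bar>) - sqrt ((norm M)\<^sup>2 - 2 * \<bar>det M\<bar>)) / 2,
       (sqrt ((norm M)\<^sup>2 + 2 * \<bar>det M\<bar>) + sqrt ((norm M)\<^sup>2 - 2 * \<bar>det M\<bar>)) / 2)"
      (is "_ = (?a, ?b)")
    and sing_vals_nonneg: "0 \<le> fst (sing_vals M)"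
    and sing_vals_fst_le_snd: "fst (sing_vals M) \<le> snd (sing_vals M)"
    and sing_vals_sum_sq: "(fst (sing_vals M))\<^sup>2 + (snd (sing_vals M))\<^sup>2 = (norm M)\<^sup>2"
    and sing_vals_mult: "fst (sing_vals M) * snd (sing_vals M) = \<bar>det M\<bar>"
proof -
  define s where "s = sqrt ((norm M)\<^sup>2 + 2 * \<bar>det M\<bar>)"
  define d where "d = sqrt ((norm M)\<^sup>2 - 2 * \<bar>det M\<bar>)"
  have s: "s\<^sup>2 = (norm M)\<^sup>2 + 2 * \<bar>det M\<bar>" and d: "d\<^sup>2 = (norm M)\<^sup>2 - 2 * \<bar>det M\<bar>"
    using abs_det_le_norm_sq[of M] by (simp_all add: s_def d_def)
  have le: "0 \<le> ?a" "?a \<le> ?b"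
    using abs_det_le_norm_sq[of M] by simp_all
  have "((s - d) / 2)\<^sup>2 + ((s + d) / 2)\<^sup>2 = (s\<^sup>2 + d\<^sup>2) / 2"
    "(s - d) / 2 * ((s + d) / 2) = (s\<^sup>2 - d\<^sup>2) / 4"
    by (simp_all add: power2_eq_square field_simps)
  then have eq: "?a\<^sup>2 + ?b\<^sup>2 = (norm M)\<^sup>2" "?a * ?b = \<bar>det M\<bar>"
    unfolding s d by (simp_all add: s_def d_def)
  show sv: "sing_vals M = (?a, ?b)"
    by (rule sing_vals_eqI[OF le eq])
  show "0 \<le> fst (sing_vals M)" "fst (sing_vals M) \<le> snd (sing_vals M)"
    "(fst (sing_vals M))\<^sup>2 + (snd (sing_vals M))\<^sup>2 = (norm M)\<^sup>2"
    "fst (sing_vals M) * snd (sing_vals M) = \<bar>det M\<bar>"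
    unfolding sv fst_conv snd_conv by (fact le eq)+
qed

lemma continuous_on_sing_vals: "continuous_on UNIV sing_vals"
  unfolding sing_vals_formula[abs_def] det_2 by (intro continuous_intros) auto

lemma norm_sing_vals: "norm (sing_vals M) = norm M"
  using sing_vals_sum_sq[of M] by (simp add: norm_prod_def)

lemma det_scaleR_mat2:
  fixes M :: mat2
  shows "det (t *\<^sub>R M) = t\<^sup>2 * det M"
  by (simp add: det_2 power2_eq_square algebra_simps)

lemma sing_vals_scaleR:
  assumes "0 \<le> t"
  shows "sing_vals (t *\<^sub>R M) = t *\<^sub>R sing_vals M"
proof -
  have "sing_vals (t *\<^sub>R M) = (t * fst (sing_vals M), t * snd (sing_vals M))"
  proof (rule sing_vals_eqI)
    show "(t * fst (sing_vals M))\<^sup>2 + (t * snd (sing_vals M))\<^sup>2 = (norm (t *\<^sub>R M))\<^sup>2"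
      by (simp add: power_mult_distrib flip: sing_vals_sum_sq distrib_left)
    have "t * fst (sing_vals M) * (t * snd (sing_vals M))
        = t\<^sup>2 * (fst (sing_vals M) * snd (sing_vals M))"
      by (simp add: power2_eq_square)
    then show "t * fst (sing_vals M) * (t * snd (sing_vals M)) = \<bar>det (t *\<^sub>R M)\<bar>"
      by (simp add: sing_vals_mult det_scaleR_mat2 abs_mult)
  qed (use assms sing_vals_nonneg sing_vals_fst_le_snd in \<open>auto intro: mult_left_mono\<close>)
  then show ?thesis
    by (simp add: scaleR_prod_def)
qed

lemma rank_eq_1_iff:
  fixes M :: mat2
  shows "rank M = 1 \<longleftrightarrow> det M = 0 \<and> M \<noteq> 0"
proof -
  have "rank M = 0 \<longleftrightarrow> M = 0"
    by (simp add: rank_eq_0)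
  moreover have "rank M \<le> 2"
    using rank_bound[of M] by simp
  moreover have "det M = 0 \<longleftrightarrow> rank M < 2"
    using det_eq_0_rank[of M] by simp
  ultimately show ?thesis
    by linarith
qed

lemma rank_scaleR_eq_1:
  fixes M :: mat2
  assumes "rank M = 1" "t \<noteq> 0"
  shows "rank (t *\<^sub>R M) = 1"
  using assms unfolding rank_eq_1_iff det_scaleR_mat2 by simp

lemma polar_decomposition_real:
  obtains r c s :: real where "0 \<le> r" "c\<^sup>2 + s\<^sup>2 = 1" "p = r * c" "q = r * s"
proof (cases "p = 0 \<and> q = 0")
  case True
  then show ?thesis
    using that[of 0 1 0] by simp
next
  case False
  define r where "r = sqrt (p\<^sup>2 + q\<^sup>2)"
  have "r\<^sup>2 = p\<^sup>2 + q\<^sup>2" "r > 0"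
    using False by (auto simp: r_def sum_power2_gt_zero_iff)
  moreover have "(p / r)\<^sup>2 + (q / r)\<^sup>2 = (p\<^sup>2 + q\<^sup>2) / r\<^sup>2"
    by (simp add: power_divide add_divide_distrib)
  ultimately have "(p / r)\<^sup>2 + (q / r)\<^sup>2 = 1"
    using False by auto
  with \<open>r > 0\<close> show ?thesis
    using that[of r "p / r" "q / r"] by simp
qed

text \<open>A singular value decomposition: \<open>xA + yB\<close> plays the role of \<open>R diag(x, y) Q\<close> with \<open>R, Q\<close> orthogonal
  and \<open>x\<close> possibly negative. It is read off the splitting of \<open>M\<close> into its conformal and
  anticonformal parts, written in polar coordinates.\<close>

lemma singular_value_decomposition:
  fixes M :: mat2
  obtains x y :: real and A B :: mat2
  where "M = x *\<^sub>R A + y *\<^sub>R B" "\<bar>x\<bar> \<le> y"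
    "\<And>u v. (norm (u *\<^sub>R A + v *\<^sub>R B))\<^sup>2 = u\<^sup>2 + v\<^sup>2" "\<And>u v. det (u *\<^sub>R A + v *\<^sub>R B) = u * v"
proof -
  obtain \<mu> c s where \<mu>: "0 \<le> \<mu>" "c\<^sup>2 + s\<^sup>2 = 1" "(M$1$1 + M$2$2) / 2 = \<mu> * c"
    "(M$2$1 - M$1$2) / 2 = \<mu> * s"
    by (rule polar_decomposition_real)
  obtain \<nu> c' s' where \<nu>: "0 \<le> \<nu>" "c'\<^sup>2 + s'\<^sup>2 = 1" "(M$1$1 - M$2$2) / 2 = \<nu> * c'"
    "(M$2$1 + M$1$2) / 2 = \<nu> * s'"
    by (rule polar_decomposition_real)
  define A where "A = (1/2) *\<^sub>R mat2_of (c - c') (- s - s') (s - s') (c + c')"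
  define B where "B = (1/2) *\<^sub>R mat2_of (c + c') (- s + s') (s + s') (c - c')"
  have M: "M = (\<mu> - \<nu>) *\<^sub>R A + (\<mu> + \<nu>) *\<^sub>R B"
    using \<mu>(3,4) \<nu>(3,4) unfolding mat2_eq_iff A_def B_def by (simp add: field_simps)
  have N: "(norm (u *\<^sub>R A + v *\<^sub>R B))\<^sup>2 = u\<^sup>2 + v\<^sup>2" for u v
  proof -
    have "(norm (u *\<^sub>R A + v *\<^sub>R B))\<^sup>2
        = (u + v)\<^sup>2 / 2 * (c\<^sup>2 + s\<^sup>2) + (u - v)\<^sup>2 / 2 * (c'\<^sup>2 + s'\<^sup>2)"
      unfolding norm_mat2_sq A_def B_def by (simp add: power2_eq_square field_simps)
    then show ?thesis
      unfolding \<mu>(2) \<nu>(2) by (simp add: power2_eq_square field_simps)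
  qed
  have D: "det (u *\<^sub>R A + v *\<^sub>R B) = u * v" for u v
  proof -
    have "det (u *\<^sub>R A + v *\<^sub>R B)
        = (u + v)\<^sup>2 / 4 * (c\<^sup>2 + s\<^sup>2) - (u - v)\<^sup>2 / 4 * (c'\<^sup>2 + s'\<^sup>2)"
      unfolding det_2 A_def B_def by (simp add: power2_eq_square field_simps)
    then show ?thesis
      unfolding \<mu>(2) \<nu>(2) by (simp add: power2_eq_square field_simps)
  qed
  show ?thesis
    using that[OF M _ N D] \<mu>(1) \<nu>(1) by auto
qed

lemma rank_one_convex_le_0:
  assumes f: "rank_one_convex f" and M: "rank M = 1"
    and le: "f (X + a *\<^sub>R M) \<le> 0" "f (X - a *\<^sub>R M) \<le> 0" and x: "\<bar>x\<bar> < a"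
  shows "f (X + x *\<^sub>R M) \<le> 0"
proof -
  define t where "t = (1 - x / a) / 2"
  have t: "0 \<le> t" "t \<le> 1"
    using x by (auto simp: t_def field_simps)
  have ta: "x = a - 2 * t * a"
    using x by (simp add: t_def field_simps)
  have "rank ((X + a *\<^sub>R M) - (X - a *\<^sub>R M)) = 1"
  proof -
    have "(X + a *\<^sub>R M) - (X - a *\<^sub>R M) = (2 * a) *\<^sub>R M"
      by (simp add: mat2_eq_iff)
    then show ?thesis
      using rank_scaleR_eq_1[OF M, of "2 * a"] x by auto
  qed
  then have "f ((1 - t) *\<^sub>R (X + a *\<^sub>R M) + t *\<^sub>R (X - a *\<^sub>R M))
      \<le> (1 - t) * f (X + a *\<^sub>R M) + t * f (X - a *\<^sub>R M)"
    using f t unfolding rank_one_convex_def by blast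
  moreover have "(1 - t) *\<^sub>R (X + a *\<^sub>R M) + t *\<^sub>R (X - a *\<^sub>R M) = X + x *\<^sub>R M"
    unfolding ta by (simp add: mat2_eq_iff algebra_simps)
  moreover have "(1 - t) * f (X + a *\<^sub>R M) \<le> 0" "t * f (X - a *\<^sub>R M) \<le> 0"
    using t le by (simp_all add: mult_nonneg_nonpos)
  ultimately show ?thesis
    by simp
qed

lemma rc_hull_contains_smaller_sing_vals:
  assumes iso: "\<And>\<zeta>. sing_vals \<zeta> = (a, b) \<Longrightarrow> \<zeta> \<in> E" and ab: "0 \<le> a" "a \<le> b"
    and M: "fst (sing_vals M) < a" "snd (sing_vals M) < b"
  shows "M \<in> rc_hull_compact E"
  unfolding rc_hull_compact_def
proof (intro CollectI allI impI)
  fix f assume f: "rank_one_convex f \<and> (\<forall>x\<in>E. f x \<le> 0)"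
  obtain x y A B where xy: "M = x *\<^sub>R A + y *\<^sub>R B" "\<bar>x\<bar> \<le> y"
    and N: "\<And>u v. (norm (u *\<^sub>R A + v *\<^sub>R B))\<^sup>2 = u\<^sup>2 + v\<^sup>2"
    and D: "\<And>u v. det (u *\<^sub>R A + v *\<^sub>R B) = u * v"
    using singular_value_decomposition[of M] by metis
  have sv: "sing_vals (u *\<^sub>R A + v *\<^sub>R B) = (\<bar>u\<bar>, \<bar>v\<bar>)" if "\<bar>u\<bar> \<le> \<bar>v\<bar>" for u v
    by (rule sing_vals_eqI) (use that in \<open>simp_all add: N D abs_mult\<close>)
  have lt: "\<bar>x\<bar> < a" "\<bar>y\<bar> < b"
    using M sv[of x y] xy by auto
  have E: "u *\<^sub>R A + v *\<^sub>R B \<in> E" if "\<bar>u\<bar> = a" "\<bar>v\<bar> = b" for u v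
    using sv[of u v] that ab iso by simp
  have rA: "rank A = 1"
    using N[of 1 0] D[of 1 0] unfolding rank_eq_1_iff by auto
  have rB: "rank B = 1"
    using N[of 0 1] D[of 0 1] unfolding rank_eq_1_iff by auto
  have side: "f (v *\<^sub>R B + x *\<^sub>R A) \<le> 0" if "\<bar>v\<bar> = b" for v
  proof (rule rank_one_convex_le_0[OF _ rA _ _ lt(1)])
    have "a *\<^sub>R A + v *\<^sub>R B \<in> E" "(- a) *\<^sub>R A + v *\<^sub>R B \<in> E"
      by (rule E; use that ab in simp)+
    then show "f (v *\<^sub>R B + a *\<^sub>R A) \<le> 0" "f (v *\<^sub>R B - a *\<^sub>R A) \<le> 0"
      using f by (auto simp: add.commute)
  qed (use f in simp)
  have "f (x *\<^sub>R A + y *\<^sub>R B) \<le> 0"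
  proof (rule rank_one_convex_le_0[OF _ rB _ _ lt(2)])
    show "f (x *\<^sub>R A + b *\<^sub>R B) \<le> 0" "f (x *\<^sub>R A - b *\<^sub>R B) \<le> 0"
      using side[of b] side[of "- b"] ab by (simp_all add: add.commute)
  qed (use f in simp)
  then show "f M \<le> 0"
    by (simp add: xy(1))
qed

lemma scaleR_in_interior_rc_hull:
  assumes iso: "\<And>\<zeta>. sing_vals \<zeta> = sing_vals \<eta> \<Longrightarrow> \<zeta> \<in> E"
    and pos: "0 < fst (sing_vals \<eta>)" and t: "0 < t" "t < 1"
  shows "t *\<^sub>R \<eta> \<in> interior (rc_hull_compact E)"
proof (rule interiorI)
  define a where "a = fst (sing_vals \<eta>)"
  define b where "b = snd (sing_vals \<eta>)"
  have ab: "sing_vals \<eta> = (a, b)"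
    by (simp add: a_def b_def)
  have "0 \<le> a" "a \<le> b"
    using sing_vals_nonneg[of \<eta>] sing_vals_fst_le_snd[of \<eta>] by (simp_all add: ab)
  let ?V = "sing_vals -` ({..<a} \<times> {..<b})"
  show "open ?V"
    by (intro continuous_open_vimage open_Times open_lessThan)
      (use continuous_on_sing_vals in \<open>simp add: continuous_on_eq_continuous_at\<close>)
  show "t *\<^sub>R \<eta> \<in> ?V"
    using t pos \<open>a \<le> b\<close> by (simp add: sing_vals_scaleR ab)
  show "?V \<subseteq> rc_hull_compact E"
    using rc_hull_contains_smaller_sing_vals[of a b E] iso \<open>0 \<le> a\<close> \<open>a \<le> b\<close> by (auto simp: ab)
qed

lemma rank_one_convex_scaleR:
  assumes f: "rank_one_convex f" and t: "t \<noteq> 0"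
  shows "rank_one_convex (\<lambda>x. f (t *\<^sub>R x))"
  unfolding rank_one_convex_def
proof (intro allI impI)
  fix X Y :: mat2 and s :: real
  assume r: "rank (X - Y) = 1" and s: "0 \<le> s \<and> s \<le> 1"
  have "rank (t *\<^sub>R X - t *\<^sub>R Y) = 1"
    using rank_scaleR_eq_1[OF r t] by (simp add: scaleR_diff_right)
  then have "f ((1 - s) *\<^sub>R t *\<^sub>R X + s *\<^sub>R t *\<^sub>R Y) \<le> (1 - s) * f (t *\<^sub>R X) + s * f (t *\<^sub>R Y)"
    using f s unfolding rank_one_convex_def by blast
  moreover have "(1 - s) *\<^sub>R t *\<^sub>R X + s *\<^sub>R t *\<^sub>R Y = t *\<^sub>R ((1 - s) *\<^sub>R X + s *\<^sub>R Y)"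
    by (simp add: scaleR_add_right mult.commute)
  ultimately show "f (t *\<^sub>R ((1 - s) *\<^sub>R X + s *\<^sub>R Y)) \<le> (1 - s) * f (t *\<^sub>R X) + s * f (t *\<^sub>R Y)"
    by simp
qed

lemma scaleR_rc_hull_subset:
  assumes "t \<noteq> 0"
  shows "(*\<^sub>R) t ` rc_hull_compact E \<subseteq> rc_hull_compact ((*\<^sub>R) t ` E)"
  using rank_one_convex_scaleR[OF _ assms] by (fastforce simp: rc_hull_compact_def)

lemma scaleR_interior_rc_hull:
  assumes "t \<noteq> 0" "x \<in> interior (rc_hull_compact E)"
  shows "t *\<^sub>R x \<in> interior (rc_hull_compact ((*\<^sub>R) t ` E))"
proof (rule interiorI)
  show "open ((*\<^sub>R) t ` interior (rc_hull_compact E))"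
    using assms(1) by (simp add: open_scaling)
  show "(*\<^sub>R) t ` interior (rc_hull_compact E) \<subseteq> rc_hull_compact ((*\<^sub>R) t ` E)"
    using scaleR_rc_hull_subset[OF assms(1), of E] interior_subset by blast
qed (use assms in auto)

theorem theorem4p8:
  fixes K :: "(real \<times> real) set" and E :: "mat2 set" and \<xi> :: mat2
  assumes "compact K"
    and "K \<subseteq> {(x, y). 0 < x \<and> x \<le> y}"
    and "E = {\<zeta>. sing_vals \<zeta> \<in> K}"
    and "\<xi> \<in> interior (rc_hull_compact E)"
  shows "\<exists>U. in_approximation U E \<and> \<xi> \<in> U 0"
proof -
  have E: "E = sing_vals -` K"
    using assms(3) by auto
  obtain R where R: "\<And>p. p \<in> K \<Longrightarrow> norm p \<le> R" "0 < R"
    using compact_imp_bounded[OF assms(1)] bounded_pos by metis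
  then have ER: "norm \<eta> \<le> R" if "\<eta> \<in> E" for \<eta>
    using that R(1)[of "sing_vals \<eta>"] by (simp add: E norm_sing_vals)
  have "closed E"
    unfolding E by (intro continuous_closed_vimage compact_imp_closed assms(1))
      (use continuous_on_sing_vals in \<open>simp add: continuous_on_eq_continuous_at\<close>)
  moreover have "bounded E"
    using ER by (auto simp: bounded_iff)
  ultimately have "compact E"
    by (simp add: compact_eq_bounded_closed)

  have "\<forall>\<^sub>F s in at_right (0::real). (1 / (1 - s / 2)) *\<^sub>R \<xi> \<in> interior (rc_hull_compact E)"
  proof (rule topological_tendstoD[where l = \<xi>])
    have "((\<lambda>s. (1 / (1 - s / 2)) *\<^sub>R \<xi>) \<longlongrightarrow> (1 / (1 - 0 / 2)) *\<^sub>R \<xi>) (at_right (0::real))"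
      by (intro tendsto_intros) auto
    then show "((\<lambda>s. (1 / (1 - s / 2)) *\<^sub>R \<xi>) \<longlongrightarrow> \<xi>) (at_right (0::real))"
      by simp
  qed (use assms(4) in auto)
  moreover have "\<forall>\<^sub>F s in at_right (0::real). 0 < s \<and> s < 1"
    unfolding eventually_at_right_field by (auto intro: exI[of _ 1])
  ultimately obtain \<delta> :: real where \<delta>: "0 < \<delta>" "\<delta> < 1"
    and \<delta>\<xi>: "(1 / (1 - \<delta> / 2)) *\<^sub>R \<xi> \<in> interior (rc_hull_compact E)"
    using eventually_happens[OF eventually_conj] by (metis (mono_tags, lifting) trivial_limit_at_right_real)

  define t where "t n = 1 - \<delta> / real (Suc n)" for n
  define C where "C n = (*\<^sub>R) (t n) ` E" for n
  define c where "c = R + 1 + infdist \<xi> E"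
  define U where "U n = interior (rc_hull_compact (C (Suc n))) \<inter> {\<eta>. infdist \<eta> E < c / real (Suc n)}" for n
  have c: "R < c" "infdist \<xi> E < c"
    using R(2) infdist_nonneg[of \<xi> E] by (auto simp: c_def)
  have t_pos: "0 < t n" for n
    using \<delta> by (simp add: t_def field_simps)
  have t_less: "t n < t (Suc n)" for n
    using \<delta> by (simp add: t_def field_simps)
  have cptC: "compact (C n)" for n
    unfolding C_def by (intro compact_scaling \<open>compact E\<close>)
  have openU: "open (U n)" for n
    unfolding U_def by (intro open_Int open_interior open_Collect_less continuous_intros)
  have C_sub_U: "C n \<subseteq> U n" for n
  proof
    fix x assume "x \<in> C n"
    then obtain \<eta> where \<eta>: "\<eta> \<in> E" "x = t n *\<^sub>R \<eta>"
      by (auto simp: C_def)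
    define r where "r = t n / t (Suc n)"
    have "r *\<^sub>R \<eta> \<in> interior (rc_hull_compact E)"
    proof (rule scaleR_in_interior_rc_hull)
      show "0 < fst (sing_vals \<eta>)"
        using \<eta>(1) assms(2) by (auto simp: E)
      show "0 < r" "r < 1"
        using t_pos t_less by (simp_all add: r_def)
    qed (use \<eta>(1) in \<open>auto simp: E\<close>)
    then have "t (Suc n) *\<^sub>R r *\<^sub>R \<eta> \<in> interior (rc_hull_compact (C (Suc n)))"
      unfolding C_def using t_pos[of "Suc n"] by (intro scaleR_interior_rc_hull) auto
    then have "x \<in> interior (rc_hull_compact (C (Suc n)))"
      using t_pos[of "Suc n"] by (simp add: r_def \<eta>(2))
    moreover have "infdist x E < c / real (Suc n)"
    proof -
      have "infdist x E \<le> dist x \<eta>"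
        using \<eta>(1) by (rule infdist_le)
      also have "\<dots> = norm ((\<delta> / real (Suc n)) *\<^sub>R \<eta>)"
        unfolding dist_norm \<eta>(2) t_def by (subst norm_minus_commute) (simp add: algebra_simps)
      also have "\<dots> = \<delta> * norm \<eta> / real (Suc n)"
        using \<delta> by simp
      also have "\<delta> * norm \<eta> \<le> 1 * R"
        using \<delta> ER[OF \<eta>(1)] by (intro mult_mono) auto
      finally show ?thesis
        using c(1) by (simp add: divide_right_mono divide_strict_right_mono order_le_less_trans)
    qed
    ultimately show "x \<in> U n"
      by (simp add: U_def)
  qed
  have "in_approximation U E"
    unfolding in_approximation_def
  proof (intro conjI allI impI)
    fix n
    have "U n \<subseteq> rc_hull_compact (C (Suc n))"
      unfolding U_def using interior_subset by blast
    then show "U n \<subseteq> rc_hull_open (U (Suc n))"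
      unfolding rc_hull_open_def using cptC C_sub_U by blast
  next
    fix \<epsilon> :: real assume "\<epsilon> > 0"
    obtain N where N: "c / \<epsilon> < real N"
      using reals_Archimedean2 by blast
    show "\<exists>N. \<forall>i\<ge>N. \<forall>\<eta>\<in>U i. infdist \<eta> E \<le> \<epsilon>"
    proof (intro exI allI impI ballI)
      fix i \<eta> assume i: "N \<le> i" and "\<eta> \<in> U i"
      then have "infdist \<eta> E < c / real (Suc i)"
        by (simp add: U_def)
      also have "c / \<epsilon> < real (Suc i)"
        using N i by simp
      then have "c / real (Suc i) \<le> \<epsilon>"
        using \<open>\<epsilon> > 0\<close> by (simp add: field_simps)
      finally show "infdist \<eta> E \<le> \<epsilon>"
        by simp
    qed
  qed (rule openU)
  moreover have "\<xi> \<in> U 0"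
  proof -
    have "t 1 *\<^sub>R (1 / (1 - \<delta> / 2)) *\<^sub>R \<xi> \<in> interior (rc_hull_compact (C 1))"
      unfolding C_def using t_pos[of 1] \<delta>\<xi> by (intro scaleR_interior_rc_hull) auto
    moreover have "t 1 * (1 / (1 - \<delta> / 2)) = 1"
      using \<delta> by (simp add: t_def)
    ultimately show ?thesis
      using c(2) by (simp add: U_def)
  qed
  ultimately show ?thesis
    by blast
qed

end
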